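(* For $n\ge 1$, let $\mathscr Q(n)$, $\mathscr O(n)$ and $\mathscr S(n)$ denote respectively the sets of non-Abelian, ordinary, and singular quadratic Lie algebra structures on the quadratic vector space $\mathbb C^n$, where $\mathscr Q(n)$ is regarded as a subset of $\bigwedge^3(\mathbb C^n)$ by sending a structure to its associated 3-form. Then: (1) $\mathscr O(n)$ is a Zariski-open subset of $\mathscr Q(n)$; (2) $\mathscr S(n)$ is a Zariski-closed subset of $\mathscr Q(n)$; (3) $\mathscr Q(n)\neq\emptyset$ if and only if $n\ge 3$; (4) $\mathscr O(n)\neq\emptyset$ if and only if $n\ge 6$.
   Context: All vector spaces are finite-dimensional over $\mathbb C$. $\bigwedge^k(V)$ denotes the space of skew-symmetric $k$-linear forms on $V$. $\mathbb C^n$ is equipped with its canonical non-degenerate symmetric bilinear form $B$: for $n=2p$ with canonical basis $\{E_1,\dots,E_p,F_1,\dots,F_p\}$, $B(E_i,F_j)=\delta_{ij}$, $B(E_i,E_j)=B(F_i,F_j)=0$; for $n=2p+1$ with canonical basis $\{E_1,\dots,E_p,G,F_1,\dots,F_p\}$, the same relations together with $B(E_i,G)=B(F_j,G)=0$, $B(G,G)=1$. A quadratic Lie algebra $(\mathfrak g,B)$ is a Lie algebra with a non-degenerate symmetric bilinear form $B$ that is invariant: $B([X,Y],Z)=B(X,[Y,Z])$. Its associated 3-form is $I\in\bigwedge^3(\mathfrak g)$, $I(X,Y,Z)=B([X,Y],Z)$. A quadratic Lie algebra structure on $\mathbb C^n$ is a Lie bracket on $\mathbb C^n$ for which the canonical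 form $B$ is invariant; it is determined by its 3-form $I$. Thus $\mathscr Q(n)$ is identified with the set of non-zero $I\in\bigwedge^3(\mathbb C^n)$ such that the bracket defined by $B([X,Y],Z)=I(X,Y,Z)$ satisfies the Jacobi identity (equivalently $\{I,I\}=0$, where for an orthonormal basis $(v_j)$ of $\mathbb C^n$, $\{I,I\}=\sum_j \iota_{v_j}(I)\wedge\iota_{v_j}(I)$, $\iota_v$ being contraction by $v$), with the topology induced by the Zariski topology of $\bigwedge^3(\mathbb C^n)$. The $\mathrm{dup}$-number of $\mathfrak g$ is $\mathrm{dup}(\mathfrak g)=\dim\{\alpha\in\mathfrak g^*\mid \alpha\wedge I=0\}$. A non-Abelian quadratic Lie algebra is ordinary if $\mathrm{dup}(\mathfrak g)=0$ and singular if $\mathrm{dup}(\mathfrak g)\ge 1$. *)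

theory Defs
  imports "HOL-Analysis.Analysis" "HOL-Library.Function_Algebras"
begin

section \<open>The quadratic space $\mathbb{C}^n$\<close>

text \<open>
  The space is \<open>complex ^ 'n\<close> with \<open>n = CARD('n)\<close>. The order on the index type only serves to
  list the standard basis as $E_1,\dots,E_p,(G,)F_1,\dots,F_p$: the vector \<open>axis i 1\<close> stands at
  the 0-based position \<open>idx_pos i\<close>, so with \<open>p = n div 2\<close> the positions \<open>0, \<dots>, p - 1\<close> carry the
  $E$'s, the last \<open>p\<close> positions \<open>n - p, \<dots>, n - 1\<close> carry the $F$'s and, for odd \<open>n\<close>, position \<open>p\<close>
  carries $G$.
\<close>

definition idx_pos :: "'n::{finite,linorder} \<Rightarrow> nat" where
  "idx_pos i = card {..<i}"

text \<open>\<open>paired i j\<close> says that the $i$-th and $j$-th basis vectors are $E_k,F_k$ (in either order)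
  or both are $G$.\<close>

definition paired :: "'n::{finite,linorder} \<Rightarrow> 'n \<Rightarrow> bool" where
  "paired i j \<longleftrightarrow>
     (let n = CARD('n); p = n div 2 in
        idx_pos j = idx_pos i + (n - p) \<or>
        idx_pos i = idx_pos j + (n - p) \<or>
        (odd n \<and> idx_pos i = p \<and> idx_pos j = p))"

definition can_form :: "(complex, 'n::{finite,linorder}) vec \<Rightarrow> (complex, 'n) vec \<Rightarrow> complex" where
  "can_form x y = (\<Sum>i\<in>UNIV. \<Sum>j\<in>UNIV. if paired i j then x $ i * y $ j else 0)"

lemma can_form_axis: "can_form (axis i 1) (axis j 1) = (if paired i j then 1 else 0)"
proof -
  have "can_form (axis i 1) (axis j 1) =
      (\<Sum>k\<in>UNIV. \<Sum>l\<in>UNIV. if l = j then if k = i then if paired i j then 1 else 0 else 0 else 0)"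
    unfolding can_form_def by (intro sum.cong refl) (auto simp: axis_def)
  then show ?thesis by simp
qed

lemma can_form_sym: "can_form x y = can_form y x"
proof -
  have "paired i j \<longleftrightarrow> paired j i" for i j :: 'a
    by (auto simp: paired_def Let_def)
  then show ?thesis
    unfolding can_form_def by (subst sum.swap) (simp add: mult.commute cong: if_cong)
qed

lemma idx_pos_less: "idx_pos (i::'n::{finite,linorder}) < CARD('n)"
  unfolding idx_pos_def by (rule psubset_card_mono) auto

lemma inj_idx_pos: "inj (idx_pos :: 'n::{finite,linorder} \<Rightarrow> nat)"
proof (rule linorder_injI)
  fix i j :: 'n assume "i < j"
  then have "{..<i} \<subset> {..<j}" by auto
  then show "idx_pos i \<noteq> idx_pos j"
    unfolding idx_pos_def by (metis finite psubset_card_mono less_irrefl)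
qed

lemma range_idx_pos: "range (idx_pos :: 'n::{finite,linorder} \<Rightarrow> nat) = {..<CARD('n)}"
  by (rule card_subset_eq) (auto simp: idx_pos_less card_image inj_idx_pos)

lemma ex1_paired: "\<exists>!j. paired (i::'n::{finite,linorder}) j"
proof -
  define n p a where "n = CARD('n)" and "p = n div 2" and "a = idx_pos i"
  have a: "a < n" by (simp add: a_def n_def idx_pos_less)
  define b where "b = (if a < p then a + (n - p) else if a < n - p then a else a - (n - p))"
  have "b < n" using a by (auto simp: b_def p_def)
  then obtain j :: 'n where j: "idx_pos j = b"
    using range_idx_pos[where 'n = 'n] by (metis imageE lessThan_iff n_def)
  have iff: "paired i k \<longleftrightarrow> idx_pos k = b" for k :: 'n
  proof -
    have k: "idx_pos k < n" by (simp add: n_def idx_pos_less)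
    have "n = 2 * p \<or> n = 2 * p + 1" by (auto simp: p_def)
    then show ?thesis
      using a k unfolding paired_def Let_def n_def[symmetric] p_def[symmetric] a_def[symmetric] b_def
      by auto
  qed
  show ?thesis
    using iff j inj_idx_pos by (metis injD)
qed

lemma can_form_nondegenerate:
  fixes x :: "(complex, 'a::{finite,linorder}) vec"
  assumes "\<And>y. can_form x y = 0" shows "x = 0"
proof (rule vec_eq_iff[THEN iffD2], rule allI)
  fix i :: 'a
  obtain j :: 'a where j: "paired i j" using ex1_paired[of i] by (elim ex1E)
  have sym: "paired k l \<longleftrightarrow> paired l k" for k l :: 'a
    by (auto simp: paired_def Let_def)
  have "can_form x (axis j 1) = (\<Sum>k\<in>UNIV. \<Sum>l\<in>UNIV. if l = j then if k = i then x $ i else 0 else 0)"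
    unfolding can_form_def
  proof (intro sum.cong refl)
    fix k l :: 'a
    have "paired k j \<longleftrightarrow> k = i" using ex1_paired[of j] j sym by metis
    then show "(if paired k l then x $ k * axis j 1 $ l else 0)
        = (if l = j then if k = i then x $ i else 0 else 0)"
      by (cases "l = j") (simp_all add: axis_def)
  qed
  then show "x $ i = 0 $ i" using assms by simp
qed


section \<open>Alternating forms and the Zariski topology on 3-forms\<close>

abbreviation linear_form :: "(complex ^ 'n \<Rightarrow> complex) \<Rightarrow> bool" where
  "linear_form \<equiv> Vector_Spaces.linear (*s) (*)"

type_synonym 'n trilinear = "complex ^ 'n \<Rightarrow> complex ^ 'n \<Rightarrow> complex ^ 'n \<Rightarrow> complex"

definition three_forms :: "'n::finite trilinear set" where
  "three_forms = {I.
     (\<forall>y z. linear_form (\<lambda>x. I x y z)) \<and>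
     (\<forall>x z. linear_form (\<lambda>y. I x y z)) \<and>
     (\<forall>x y. linear_form (\<lambda>z. I x y z)) \<and>
     (\<forall>x y z. I y x z = - I x y z) \<and>
     (\<forall>x y z. I x z y = - I x y z)}"

definition wedge13 ::
    "(complex ^ 'n \<Rightarrow> complex) \<Rightarrow> 'n trilinear \<Rightarrow>
     complex ^ 'n \<Rightarrow> complex ^ 'n \<Rightarrow> complex ^ 'n \<Rightarrow> complex ^ 'n \<Rightarrow> complex" where
  "wedge13 \<alpha> I x y z w = \<alpha> x * I y z w - \<alpha> y * I x z w + \<alpha> z * I x y w - \<alpha> w * I x y z"

text \<open>Polynomials in the coordinates of a 3-form, i.e. in its values on triples of standard basis
  vectors.\<close>

inductive polynomial_fun :: "('n::finite trilinear \<Rightarrow> complex) \<Rightarrow> bool" where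
  const: "polynomial_fun (\<lambda>I. c)"
| coord: "polynomial_fun (\<lambda>I. I (axis i 1) (axis j 1) (axis k 1))"
| add: "polynomial_fun f \<Longrightarrow> polynomial_fun g \<Longrightarrow> polynomial_fun (\<lambda>I. f I + g I)"
| mult: "polynomial_fun f \<Longrightarrow> polynomial_fun g \<Longrightarrow> polynomial_fun (\<lambda>I. f I * g I)"

definition zariski :: "'n::finite trilinear topology" where
  "zariski = topology (\<lambda>U. \<exists>P. (\<forall>f\<in>P. polynomial_fun f) \<and>
     U = three_forms - {I \<in> three_forms. \<forall>f\<in>P. f I = 0})"

lemma openin_zariski:
  "openin zariski (U :: 'a::finite trilinear set) \<longleftrightarrow> (\<exists>P. (\<forall>f\<in>P. polynomial_fun f) \<and>
     U = three_forms - {I \<in> three_forms. \<forall>f\<in>P. f I = 0})"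
proof -
  define V :: "('a trilinear \<Rightarrow> complex) set \<Rightarrow> 'a trilinear set"
    where "V P = three_forms - {I \<in> three_forms. \<forall>f\<in>P. f I = 0}" for P
  have V: "I \<in> V P \<longleftrightarrow> I \<in> three_forms \<and> (\<exists>f\<in>P. f I \<noteq> 0)" for I P
    by (auto simp: V_def)
  have "istopology (\<lambda>U. \<exists>P. (\<forall>f\<in>P. polynomial_fun f) \<and> U = V P)"
    unfolding istopology_def
  proof (intro conjI allI impI)
    fix S T :: "'a trilinear set"
    assume "\<exists>P. (\<forall>f\<in>P. polynomial_fun f) \<and> S = V P"
    then obtain P where P: "\<forall>f\<in>P. polynomial_fun f" "S = V P" by (elim exE conjE)
    assume "\<exists>P. (\<forall>f\<in>P. polynomial_fun f) \<and> T = V P"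
    then obtain Q where Q: "\<forall>f\<in>Q. polynomial_fun f" "T = V Q" by (elim exE conjE)
    let ?R = "(\<lambda>(f, g) I. f I * g I) ` (P \<times> Q)"
    have "\<forall>h\<in>?R. polynomial_fun h" using P(1) Q(1) by (auto intro: polynomial_fun.mult)
    moreover have "I \<in> S \<inter> T \<longleftrightarrow> I \<in> V ?R" for I
      unfolding P(2) Q(2) by (simp add: V) blast
    ultimately show "\<exists>P. (\<forall>f\<in>P. polynomial_fun f) \<and> S \<inter> T = V P"
      by (intro exI[of _ ?R] conjI set_eqI)
  next
    fix \<K> :: "'a trilinear set set"
    assume "\<forall>K\<in>\<K>. \<exists>P. (\<forall>f\<in>P. polynomial_fun f) \<and> K = V P"
    from bchoice[OF this] obtain P
      where P: "\<forall>K\<in>\<K>. (\<forall>f\<in>P K. polynomial_fun f) \<and> K = V (P K)" by (elim exE)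
    have "I \<in> \<Union>\<K> \<longleftrightarrow> I \<in> V (\<Union>K\<in>\<K>. P K)" for I
    proof -
      have "I \<in> \<Union>\<K> \<longleftrightarrow> (\<exists>K\<in>\<K>. I \<in> V (P K))"
        unfolding Union_iff using P by (intro bex_cong refl) simp
      then show ?thesis by (auto simp: V)
    qed
    moreover have "\<forall>f\<in>(\<Union>K\<in>\<K>. P K). polynomial_fun f" using P by simp
    ultimately show "\<exists>P. (\<forall>f\<in>P. polynomial_fun f) \<and> \<Union>\<K> = V P"
      by (intro exI[of _ "\<Union>K\<in>\<K>. P K"] conjI set_eqI)
  qed
  then show ?thesis unfolding V_def by (simp add: zariski_def)
qed

lemma closedin_zariski:
  "closedin zariski (C :: 'a::finite trilinear set) \<longleftrightarrow>
     (\<exists>P. (\<forall>f\<in>P. polynomial_fun f) \<and> C = {I \<in> three_forms. \<forall>f\<in>P. f I = 0})"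
proof -
  have top: "topspace zariski = (three_forms :: 'a trilinear set)"
  proof
    show "topspace zariski \<subseteq> (three_forms :: 'a trilinear set)"
      using openin_topspace[of "zariski :: 'a trilinear topology"] unfolding openin_zariski by blast
    have "openin zariski (three_forms :: 'a trilinear set)"
      unfolding openin_zariski
      by (rule exI[of _ "{\<lambda>I. 1}"]) (auto intro: polynomial_fun.const)
    then show "(three_forms :: 'a trilinear set) \<subseteq> topspace zariski" by (rule openin_subset)
  qed
  have eq: "C \<subseteq> three_forms \<and> three_forms - C = three_forms - Z \<longleftrightarrow> C = Z"
    if "Z \<subseteq> three_forms" for Z using that by blast
  have "closedin zariski C \<longleftrightarrow> (\<exists>P. (\<forall>f\<in>P. polynomial_fun f) \<and>
      C \<subseteq> three_forms \<and> three_forms - C = three_forms - {I \<in> three_forms. \<forall>f\<in>P. f I = 0})"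
    unfolding closedin_def top openin_zariski by blast
  also have "\<dots> \<longleftrightarrow> (\<exists>P. (\<forall>f\<in>P. polynomial_fun f) \<and> C = {I \<in> three_forms. \<forall>f\<in>P. f I = 0})"
    by (simp add: eq)
  finally show ?thesis .
qed


section \<open>Quadratic Lie algebra structures\<close>

type_synonym 'n bracket = "complex ^ 'n \<Rightarrow> complex ^ 'n \<Rightarrow> complex ^ 'n"

definition lie_bracket :: "'n::finite bracket \<Rightarrow> bool" where
  "lie_bracket L \<longleftrightarrow>
     (\<forall>y. Vector_Spaces.linear (*s) (*s) (\<lambda>x. L x y)) \<and>
     (\<forall>x. Vector_Spaces.linear (*s) (*s) (\<lambda>y. L x y)) \<and>
     (\<forall>x. L x x = 0) \<and>
     (\<forall>x y z. L x (L y z) + L y (L z x) + L z (L x y) = 0)"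

definition quadratic_structure :: "'n::{finite,linorder} bracket \<Rightarrow> bool" where
  "quadratic_structure L \<longleftrightarrow>
     lie_bracket L \<and> (\<forall>x y z. can_form (L x y) z = can_form x (L y z))"

definition abelian :: "'n::finite bracket \<Rightarrow> bool" where
  "abelian L \<longleftrightarrow> (\<forall>x y. L x y = 0)"

definition assoc_form :: "'n::{finite,linorder} bracket \<Rightarrow> 'n trilinear" where
  "assoc_form L x y z = can_form (L x y) z"

definition scale_fun :: "complex \<Rightarrow> ('v \<Rightarrow> complex) \<Rightarrow> 'v \<Rightarrow> complex" where
  "scale_fun c \<alpha> = (\<lambda>x. c * \<alpha> x)"

interpretation fun_space: vector_space "scale_fun :: complex \<Rightarrow> ('v \<Rightarrow> complex) \<Rightarrow> 'v \<Rightarrow> complex"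
  by unfold_locales (auto simp: scale_fun_def plus_fun_def fun_eq_iff algebra_simps)

text \<open>\<open>fun_space.dim\<close> is the dimension of a subspace of the space of all complex functions; here it is
  applied to a subspace of the (finite-dimensional) dual.\<close>

definition dup_number :: "'n::{finite,linorder} bracket \<Rightarrow> nat" where
  "dup_number L = fun_space.dim
     {\<alpha>. linear_form \<alpha> \<and> (\<forall>x y z w. wedge13 \<alpha> (assoc_form L) x y z w = 0)}"

definition ordinary :: "'n::{finite,linorder} bracket \<Rightarrow> bool" where
  "ordinary L \<longleftrightarrow> \<not> abelian L \<and> dup_number L = 0"

definition singular :: "'n::{finite,linorder} bracket \<Rightarrow> bool" where
  "singular L \<longleftrightarrow> \<not> abelian L \<and> dup_number L \<ge> 1"

definition Q_set :: "'n::{finite,linorder} trilinear set" where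
  "Q_set = assoc_form ` {L. quadratic_structure L \<and> \<not> abelian L}"

definition O_set :: "'n::{finite,linorder} trilinear set" where
  "O_set = assoc_form ` {L. quadratic_structure L \<and> ordinary L}"

definition S_set :: "'n::{finite,linorder} trilinear set" where
  "S_set = assoc_form ` {L. quadratic_structure L \<and> singular L}"

lemma can_form_linear_left: "linear_form (\<lambda>x. can_form x y)"
proof unfold_locales
  show "can_form (u + v) y = can_form u y + can_form v y" for u v
    unfolding can_form_def sum.distrib[symmetric]
    by (intro sum.cong refl) (simp add: distrib_right)
  show "can_form (c *s u) y = c * can_form u y" for c u
    unfolding can_form_def sum_distrib_left
    by (intro sum.cong refl) simp
qed

lemma can_form_linear_right: "linear_form (\<lambda>y. can_form x y)"
  using can_form_linear_left by (subst can_form_sym)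

lemma Q_set_subset_three_forms: "Q_set \<subseteq> three_forms"
proof
  fix I :: "'a trilinear" assume "I \<in> Q_set"
  then obtain L :: "'a bracket" where L: "quadratic_structure L" and I: "I = assoc_form L"
    by (auto simp: Q_set_def)
  have lin1: "Vector_Spaces.linear (*s) (*s) (\<lambda>x. L x y)"
    and lin2: "Vector_Spaces.linear (*s) (*s) (\<lambda>x. L y x)" and alt: "L y y = 0"
    and inv: "can_form (L x y) z = can_form x (L y z)" for x y z
    using L by (auto simp: quadratic_structure_def lie_bracket_def)
  have skew: "L y x = - L x y" for x y
  proof -
    have "L (x + y) (x + y) = L x x + L x y + (L y x + L y y)"
      by (simp add: module_hom.add[OF Vector_Spaces.linear.axioms(3)[OF lin1]]
          module_hom.add[OF Vector_Spaces.linear.axioms(3)[OF lin2]] add_ac)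
    then have "L x y + L y x = 0" by (simp add: alt)
    then show ?thesis by (metis add.commute add_eq_0_iff)
  qed
  have neg: "can_form (- x) y = - can_form x y" "can_form y (- x) = - can_form y x" for x y :: "(complex, 'a) vec"
    using module_hom.neg[OF Vector_Spaces.linear.axioms(3)[OF can_form_linear_left]]
      module_hom.neg[OF Vector_Spaces.linear.axioms(3)[OF can_form_linear_right]] by metis+
  have "linear_form (\<lambda>x. can_form (L x y) z)" "linear_form (\<lambda>x. can_form (L y x) z)" for y z
    using Vector_Spaces.linear_compose[OF lin1 can_form_linear_left]
      Vector_Spaces.linear_compose[OF lin2 can_form_linear_left] unfolding o_def .
  moreover have "can_form (L y x) z = - can_form (L x y) z" for x y z
    unfolding skew[of y x] neg ..
  moreover have "can_form (L x z) y = - can_form (L x y) z" for x y z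
    unfolding inv skew[of z y] neg by simp
  ultimately show "I \<in> three_forms"
    unfolding I three_forms_def assoc_form_def mem_Collect_eq
    using can_form_linear_right by (intro conjI allI)
qed

end

theory Submission
  imports Defs
begin

text \<open>
  Everything is controlled by one property of a 3-form \<open>I\<close>: the existence of a non-zero linear form
  \<open>\<alpha>\<close> with \<open>\<alpha> \<and> I = 0\<close>, that is, of a linear factor of \<open>I\<close>. Since the dual space is
  finite-dimensional, the dup-number is positive exactly when the associated 3-form has a linear
  factor (\<open>dup_number_eq_0_iff\<close>), so singular and ordinary structures are the intersection of
  \<open>Q_set\<close> with the forms having, respectively not having, a linear factor.

  A 3-form \<open>I\<close> has a linear factor iff the linear map \<open>\<alpha> \<mapsto> \<alpha> \<and> I\<close> is not injective, iff all
  maximal minors of its matrix vanish (\<open>kernel_iff_minors\<close>). The entries of that matrix are linear in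
  the coordinates of \<open>I\<close>, hence the minors are polynomials and the condition is Zariski closed.

  In small dimensions, linear factors are forced by alternation alone. An alternating 3-form that
  does not vanish takes a non-zero value on three distinct basis vectors, so $n \ge 3$. If $n \le 4$,
  contracting \<open>I\<close> with two of these vectors gives a linear factor (\<open>linear_factor_dim_le_4\<close>). If
  $n = 5$, a volume form turns \<open>I\<close> into a 2-form whose kernel consists of the linear factors
  of \<open>I\<close>; a skew-symmetric matrix of odd size is singular, so this kernel is not zero
  (\<open>linear_factor_dim_5\<close>). Hence ordinary structures need $n \ge 6$.

  Conversely, every decomposable form $a^\flat \wedge b^\flat \wedge c^\flat$, where
  $a^\flat = B(a, \cdot)$, satisfies the Jacobi identity, whatever the Gram matrix of \<open>a, b, c\<close> is
  (\<open>quadratic_structure_triple_bracket\<close>); with independent vectors it is non-zero. For $n \ge 6$ there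
  are two orthogonal triples of vectors that together are independent. The two brackets then
  annihilate each other's values, so their sum is again a structure
  (\<open>quadratic_structure_add\<close>), and a sum of two decomposable forms in six independent
  covectors has no linear factor (\<open>no_linear_factor\<close>).
\<close>

section \<open>Linear and alternating forms\<close>

lemma linear_form_iff:
  "linear_form \<phi> \<longleftrightarrow> (\<forall>x y. \<phi> (x + y) = \<phi> x + \<phi> y) \<and> (\<forall>c x. \<phi> (c *s x) = c * \<phi> x)"
proof -
  have "vector_space ((*s) :: complex \<Rightarrow> complex ^ 'a \<Rightarrow> complex ^ 'a)"
    and "vector_space ((*) :: complex \<Rightarrow> complex \<Rightarrow> complex)"
    by (unfold_locales; simp add: vec_eq_iff algebra_simps)+
  then show ?thesis by (simp add: Vector_Spaces.linear_iff)
qed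

lemma linear_form_0: "linear_form \<phi> \<Longrightarrow> \<phi> 0 = 0"
  by (metis linear_form_iff add_cancel_right_left)

lemma linear_form_sum: "linear_form \<phi> \<Longrightarrow> \<phi> (\<Sum>i\<in>A. f i) = (\<Sum>i\<in>A. \<phi> (f i))"
  by (induction A rule: infinite_finite_induct) (simp_all add: linear_form_0 linear_form_iff)

lemma linear_form_expansion:
  assumes "linear_form \<phi>"
  shows "\<phi> x = (\<Sum>i\<in>UNIV. x $ i * \<phi> (axis i 1))"
proof -
  have "\<phi> x = \<phi> (\<Sum>i\<in>UNIV. x $ i *s axis i 1)" by (simp only: basis_expansion)
  also have "\<dots> = (\<Sum>i\<in>UNIV. x $ i * \<phi> (axis i 1))"
    using assms by (simp only: linear_form_sum) (simp add: linear_form_iff)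
  finally show ?thesis .
qed

lemma linear_form_eq_0:
  assumes "linear_form \<phi>" "\<And>i. \<phi> (axis i 1) = 0"
  shows "\<phi> x = 0"
  using linear_form_expansion[OF assms(1), of x] assms(2) by simp

lemma three_forms_linear:
  assumes "I \<in> three_forms"
  shows "linear_form (\<lambda>x. I x y z)" "linear_form (\<lambda>y. I x y z)" "linear_form (\<lambda>z. I x y z)"
  using assms unfolding three_forms_def mem_Collect_eq by (elim conjE, iprover)+

lemma three_forms_swap:
  assumes "I \<in> three_forms"
  shows "I y x z = - I x y z" "I x z y = - I x y z"
  using assms unfolding three_forms_def mem_Collect_eq by (elim conjE, iprover)+

lemma three_forms_repeat:
  assumes "I \<in> three_forms"
  shows "I x x z = 0" "I x z z = 0" "I x z x = 0"
proof -
  have neg: "a = - a \<Longrightarrow> a = 0" for a :: complex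
    by (simp add: complex_eq_iff)
  show "I x x z = 0" "I x z z = 0" for x z
    using neg[OF three_forms_swap(1)[OF assms, of x x z]]
      neg[OF three_forms_swap(2)[OF assms, of x z z]] by simp_all
  then show "I x z x = 0" using three_forms_swap(1)[OF assms, of x z x] by simp
qed

lemma three_form_eq_0:
  assumes "I \<in> three_forms" "\<And>i j k. I (axis i 1) (axis j 1) (axis k 1) = 0"
  shows "I x y z = 0"
proof -
  have "I (axis i 1) (axis j 1) z = 0" for i j z
    using linear_form_eq_0[OF three_forms_linear(3)[OF assms(1)]] assms(2) .
  then have "I (axis i 1) y z = 0" for i y z
    using linear_form_eq_0[OF three_forms_linear(2)[OF assms(1)]] by blast
  then show ?thesis
    using linear_form_eq_0[OF three_forms_linear(1)[OF assms(1)]] by blast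
qed

lemma three_form_coordinate_distinct:
  assumes "I \<in> three_forms" "I (axis i 1) (axis j 1) (axis k 1) \<noteq> 0"
  shows "i \<noteq> j" "j \<noteq> k" "i \<noteq> k"
  using three_forms_repeat[OF assms(1)] assms(2) by metis+

lemma wedge13_linear:
  assumes "linear_form \<alpha>" "I \<in> three_forms"
  shows "linear_form (\<lambda>x. wedge13 \<alpha> I x y z w)" "linear_form (\<lambda>y. wedge13 \<alpha> I x y z w)"
    "linear_form (\<lambda>z. wedge13 \<alpha> I x y z w)" "linear_form (\<lambda>w. wedge13 \<alpha> I x y z w)"
  using assms(1) three_forms_linear[OF assms(2)]
  by (simp_all add: linear_form_iff wedge13_def algebra_simps)

lemma wedge13_swap:
  assumes "I \<in> three_forms"
  shows "wedge13 \<alpha> I y x z w = - wedge13 \<alpha> I x y z w"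
    "wedge13 \<alpha> I x z y w = - wedge13 \<alpha> I x y z w"
    "wedge13 \<alpha> I x y w z = - wedge13 \<alpha> I x y z w"
proof -
  have "I y x z = - I x y z" "I y x w = - I x y w" "I z y w = - I y z w" "I x z y = - I x y z"
    "I x w z = - I x z w" "I y w z = - I y z w"
    by (rule three_forms_swap[OF assms])+
  then show "wedge13 \<alpha> I y x z w = - wedge13 \<alpha> I x y z w"
    "wedge13 \<alpha> I x z y w = - wedge13 \<alpha> I x y z w"
    "wedge13 \<alpha> I x y w z = - wedge13 \<alpha> I x y z w"
    by (simp_all add: wedge13_def)
qed

lemma wedge13_eq_0_swap:
  assumes "I \<in> three_forms"
  shows "wedge13 \<alpha> I x y z w = 0 \<Longrightarrow> wedge13 \<alpha> I y x z w = 0"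
    "wedge13 \<alpha> I x y z w = 0 \<Longrightarrow> wedge13 \<alpha> I x z y w = 0"
    "wedge13 \<alpha> I x y z w = 0 \<Longrightarrow> wedge13 \<alpha> I x y w z = 0"
  using wedge13_swap(1)[OF assms, of \<alpha> y x z w] wedge13_swap(2)[OF assms, of \<alpha> x z y w]
    wedge13_swap(3)[OF assms, of \<alpha> x y w z] by simp_all

lemma wedge13_repeat:
  assumes "I \<in> three_forms"
  shows "wedge13 \<alpha> I x x y z = 0"
  by (simp add: wedge13_def three_forms_repeat[OF assms])

lemma wedge13_eq_0_axis:
  assumes "linear_form \<alpha>" "I \<in> three_forms"
    and "\<And>a b c d. wedge13 \<alpha> I (axis a 1) (axis b 1) (axis c 1) (axis d 1) = 0"
  shows "wedge13 \<alpha> I x y z w = 0"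
proof -
  note lin = linear_form_eq_0[OF wedge13_linear(1)[OF assms(1,2)]]
    linear_form_eq_0[OF wedge13_linear(2)[OF assms(1,2)]]
    linear_form_eq_0[OF wedge13_linear(3)[OF assms(1,2)]]
    linear_form_eq_0[OF wedge13_linear(4)[OF assms(1,2)]]
  have "wedge13 \<alpha> I (axis a 1) (axis b 1) (axis c 1) w = 0" for a b c w
    using lin(4) assms(3) .
  then have "wedge13 \<alpha> I (axis a 1) (axis b 1) z w = 0" for a b z w
    using lin(3) by blast
  then have "wedge13 \<alpha> I (axis a 1) y z w = 0" for a y z w
    using lin(2) by blast
  then show ?thesis
    using lin(1) by blast
qed

text \<open>
  Adjacent transpositions generate the symmetric group, so for a quadruple without repetition
  only its sorted arrangement matters. The sorting is by insertion, one entry at a time.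
\<close>

lemma symmetric_relation4_sorted:
  fixes Z :: "'i::linorder \<Rightarrow> 'i \<Rightarrow> 'i \<Rightarrow> 'i \<Rightarrow> bool"
  assumes swap: "\<And>a b c d. Z a b c d \<Longrightarrow> Z b a c d" "\<And>a b c d. Z a b c d \<Longrightarrow> Z a c b d"
      "\<And>a b c d. Z a b c d \<Longrightarrow> Z a b d c"
    and rep: "\<And>a b c. Z a a b c"
    and sorted: "\<And>a b c d. a < b \<Longrightarrow> b < c \<Longrightarrow> c < d \<Longrightarrow> Z a b c d"
  shows "Z a b c d"
proof -
  have rep2: "Z a b b c" "Z a b c c" for a b c
    using swap(1)[OF swap(2)[OF rep]]
      swap(2)[OF swap(3)[OF swap(1)[OF swap(2)[OF rep]]]] by simp_all
  have three: "Z a b c d" if "a < b" "b < c" for a b c d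
  proof -
    consider "d < a" | "d = a" | "a < d" "d < b" | "d = b" | "b < d" "d < c" | "d = c" | "c < d"
      using linorder_less_linear[of d a] linorder_less_linear[of d b] linorder_less_linear[of d c]
      by blast
    then show ?thesis
    proof cases
      case 1 then show ?thesis using swap(3)[OF swap(2)[OF swap(1)[OF sorted[of d a b c]]]] that by simp
    next
      case 2 then show ?thesis using swap(3)[OF swap(2)[OF rep]] by simp
    next
      case 3 then show ?thesis using swap(3)[OF swap(2)[OF sorted[of a d b c]]] that by simp
    next
      case 4 then show ?thesis using swap(3)[OF rep2(1)] by simp
    next
      case 5 then show ?thesis using swap(3)[OF sorted[of a b d c]] that by simp
    next
      case 6 then show ?thesis using rep2(2) by simp
    next
      case 7 then show ?thesis using sorted that by simp
    qed
  qed
  have two: "Z a b c d" if "a < b" for a b c d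
  proof -
    consider "c < a" | "c = a" | "a < c" "c < b" | "c = b" | "b < c"
      using linorder_less_linear[of c a] linorder_less_linear[of c b] by blast
    then show ?thesis
    proof cases
      case 1 then show ?thesis using swap(2)[OF swap(1)[OF three[of c a b d]]] that by simp
    next
      case 2 then show ?thesis using swap(2)[OF rep] by simp
    next
      case 3 then show ?thesis using swap(2)[OF three[of a c b d]] by simp
    next
      case 4 then show ?thesis using rep2(1) by simp
    next
      case 5 then show ?thesis using three[of a b c d] that by simp
    qed
  qed
  consider "a < b" | "a = b" | "b < a"
    using linorder_less_linear[of a b] by blast
  then show ?thesis
    using two[of a b c d] swap(1)[OF two[of b a c d]] rep by cases simp_all
qed

text \<open>
  Adjacent transpositions also move any two entries of a quadruple to its front.
\<close>

lemma symmetric_relation4_contains: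
  assumes swap: "\<And>a b c d. Z a b c d \<Longrightarrow> Z b a c d" "\<And>a b c d. Z a b c d \<Longrightarrow> Z a c b d"
      "\<And>a b c d. Z a b c d \<Longrightarrow> Z a b d c"
    and ij: "\<And>c d. Z i j c d" "i \<noteq> j" "{i, j} \<subseteq> {a, b, c, d}"
  shows "Z a b c d"
proof -
  have first: "Z i b c d" if "j \<in> {b, c, d}" for b c d
  proof -
    from that consider "j = b" | "j = c" | "j = d" by blast
    then show ?thesis
      using ij(1) swap(2)[OF ij(1)] swap(3)[OF swap(2)[OF ij(1)]] by cases simp_all
  qed
  from ij(3) consider "i = a" | "i = b" | "i = c" | "i = d" by blast
  then show ?thesis
  proof cases
    case 1 then show ?thesis using first[of b c d] ij(2,3) by blast
  next
    case 2 then show ?thesis using swap(1)[OF first[of a c d]] ij(2,3) by blast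
  next
    case 3 then show ?thesis using swap(2)[OF swap(1)[OF first[of a b d]]] ij(2,3) by blast
  next
    case 4
    then show ?thesis using swap(3)[OF swap(2)[OF swap(1)[OF first[of a b c]]]] ij(2,3) by blast
  qed
qed

text \<open>
  By alternation, a 4-form is determined by its values on increasing quadruples of basis vectors. This
  reduces the vanishing of \<open>\<alpha> \<and> I\<close> to a single equation in dimension 4 and to five in dimension 5.
\<close>

lemma wedge13_eq_0_sorted:
  fixes I :: "'n::{finite,linorder} trilinear"
  assumes "linear_form \<alpha>" "I \<in> three_forms"
    and "\<And>a b c d. a < b \<Longrightarrow> b < c \<Longrightarrow> c < d \<Longrightarrow>
      wedge13 \<alpha> I (axis a 1) (axis b 1) (axis c 1) (axis d 1) = 0"
  shows "wedge13 \<alpha> I x y z w = 0"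
proof (rule wedge13_eq_0_axis[OF assms(1,2)])
  show "wedge13 \<alpha> I (axis a 1) (axis b 1) (axis c 1) (axis d 1) = 0" for a b c d
    by (rule symmetric_relation4_sorted[where
          Z = "\<lambda>a b c d. wedge13 \<alpha> I (axis a 1) (axis b 1) (axis c 1) (axis d 1) = 0"])
      (erule wedge13_eq_0_swap[OF assms(2)] | simp add: wedge13_repeat assms(2,3))+
qed

section \<open>Linear factors\<close>

definition has_linear_factor :: "'n::finite trilinear \<Rightarrow> bool" where
  "has_linear_factor I \<longleftrightarrow>
     (\<exists>\<alpha>. linear_form \<alpha> \<and> (\<exists>v. \<alpha> v \<noteq> 0) \<and> (\<forall>x y z w. wedge13 \<alpha> I x y z w = 0))"

text \<open>
  The dimension in \<open>dup_number\<close> is taken in the infinite-dimensional space of all functions, where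
  it is 0 also for spaces without a finite basis. Here the coordinate functions span the dual, so 0
  really means that the annihilator is trivial.
\<close>

lemma dup_number_eq_0_iff:
  fixes L :: "'n::{finite,linorder} bracket"
  shows "dup_number L = 0 \<longleftrightarrow> \<not> has_linear_factor (assoc_form L)"
proof -
  define V where "V = {\<alpha>. linear_form \<alpha> \<and> (\<forall>x y z w. wedge13 \<alpha> (assoc_form L) x y z w = 0)}"
  define T where "T = range (\<lambda>i (x :: (complex, 'n) vec). x $ i)"
  have coord_sum: "sum f S x = (\<Sum>i\<in>S. f i x)"
    for f :: "'n \<Rightarrow> (complex, 'n) vec \<Rightarrow> complex" and S x
    by (induction S rule: infinite_finite_induct) simp_all
  have V_sub: "V \<subseteq> fun_space.span T"
  proof
    fix \<alpha> assume "\<alpha> \<in> V"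
    then have "\<alpha> = (\<lambda>x. \<Sum>i\<in>UNIV. x $ i * \<alpha> (axis i 1))"
      using linear_form_expansion unfolding V_def by blast
    also have "\<dots> = (\<Sum>i\<in>UNIV. scale_fun (\<alpha> (axis i 1)) (\<lambda>x. x $ i))"
      by (rule ext) (simp add: coord_sum scale_fun_def mult.commute)
    also have "\<dots> \<in> fun_space.span T"
      by (intro fun_space.span_sum fun_space.span_scale fun_space.span_base) (simp add: T_def)
    finally show "\<alpha> \<in> fun_space.span T" .
  qed
  obtain B where B: "B \<subseteq> V" "fun_space.independent B" "V \<subseteq> fun_space.span B"
      "card B = fun_space.dim V"
    using fun_space.basis_exists by blast
  have "finite T" by (simp add: T_def)
  then have "finite B"
    using fun_space.independent_span_bound B(1,2) V_sub by blast
  then have "fun_space.dim V = 0 \<longleftrightarrow> B = {}"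
    using B(4) by auto
  also have "\<dots> \<longleftrightarrow> V \<subseteq> {0}"
  proof
    show "B = {} \<Longrightarrow> V \<subseteq> {0}" using B(3) by simp
    show "V \<subseteq> {0} \<Longrightarrow> B = {}"
      using B(1,2) fun_space.dependent_zero by blast
  qed
  also have "\<dots> \<longleftrightarrow> \<not> has_linear_factor (assoc_form L)"
    unfolding V_def has_linear_factor_def by (auto simp: fun_eq_iff)
  finally show ?thesis unfolding dup_number_def V_def .
qed

lemma abelian_iff_assoc_form:
  "abelian L \<longleftrightarrow> (\<forall>x y z. assoc_form L x y z = 0)"
  using can_form_nondegenerate[of "L _ _"] linear_form_0[OF can_form_linear_left]
  unfolding abelian_def assoc_form_def by metis

lemma O_set_eq: "O_set = Q_set - {I. has_linear_factor I}"
  unfolding O_set_def Q_set_def ordinary_def by (auto simp: dup_number_eq_0_iff)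

lemma S_set_eq: "S_set = Q_set \<inter> {I. has_linear_factor I}"
proof -
  have "1 \<le> dup_number L \<longleftrightarrow> has_linear_factor (assoc_form L)" for L :: "'a bracket"
    using dup_number_eq_0_iff[of L] by auto
  then show ?thesis unfolding S_set_def Q_set_def singular_def by auto
qed

section \<open>Having a linear factor is a closed condition\<close>

text \<open>
  If no vector is killed by \<open>A\<close>, the rows span the whole space and therefore contain a basis; the
  minor formed by the rows of this basis is non-zero.
\<close>

lemma kernel_iff_minors:
  fixes A :: "'a::field ^ 'n ^ 'm"
  shows "(\<exists>x. x \<noteq> 0 \<and> A *v x = 0) \<longleftrightarrow> (\<forall>r. det (\<chi> i. A $ r i) = 0)"
proof
  assume "\<exists>x. x \<noteq> 0 \<and> A *v x = 0"
  then obtain x where x: "x \<noteq> 0" "A *v x = 0" by blast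
  show "\<forall>r. det (\<chi> i. A $ r i) = 0"
  proof
    fix r :: "'n \<Rightarrow> 'm"
    have "(\<chi> i. A $ r i) *v x = 0"
      using x(2) by (simp add: vec_eq_iff matrix_vector_mult_def)
    then have "\<not> invertible (\<chi> i. A $ r i)"
      unfolding invertible_left_inverse matrix_left_invertible_ker using x(1) by blast
    then show "det (\<chi> i. A $ r i) = 0" by (simp add: invertible_det_nz)
  qed
next
  assume minors: "\<forall>r. det (\<chi> i. A $ r i) = 0"
  show "\<exists>x. x \<noteq> 0 \<and> A *v x = 0"
  proof (rule ccontr)
    assume "\<nexists>x. x \<noteq> 0 \<and> A *v x = 0"
    then have span: "vec.span (rows A) = UNIV"
      unfolding matrix_left_invertible_span_rows_gen[symmetric] matrix_left_invertible_ker by blast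
    obtain B where B: "B \<subseteq> rows A" "vec.independent B" "rows A \<subseteq> vec.span B"
      by (rule vec.maximal_independent_subset)
    have spanB: "vec.span B = UNIV"
      using vec.span_minimal[OF B(3) vec.subspace_span] span by auto
    then have "card B = CARD('n)"
      using vec.dim_eq_card[of B UNIV] B(2) by (simp add: vec.dim_UNIV card_cart_basis)
    moreover have "finite B" using vec.finiteI_independent[OF B(2)] .
    ultimately obtain f where f: "bij_betw f (UNIV :: 'n set) B"
      using finite_same_card_bij[of "UNIV :: 'n set" B] by auto
    have "\<exists>r. \<forall>i. A $ r i = f i"
    proof (rule choice, rule allI)
      fix i
      have "f i \<in> rows A" using B(1) bij_betwE[OF f] by auto
      then show "\<exists>k. A $ k = f i" by (auto simp: rows_def row_def vec_lambda_eta)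
    qed
    then obtain r where r: "\<And>i. A $ r i = f i" by blast
    have "rows (\<chi> i. A $ r i) = B"
      using f unfolding bij_betw_def rows_def row_def by (auto simp: r vec_lambda_eta)
    then have "invertible (\<chi> i. A $ r i)"
      unfolding invertible_left_inverse matrix_left_invertible_span_rows_gen using spanB by simp
    then show False using minors by (simp add: invertible_det_nz)
  qed
qed

text \<open>
  The matrix of \<open>\<alpha> \<mapsto> \<alpha> \<and> I\<close> with respect to the standard bases: the rows run over all quadruples of
  basis vectors, repetitions included; for an alternating \<open>I\<close> this only adds zero rows and copies up to sign.
\<close>

definition wedge_matrix :: "'n::finite trilinear \<Rightarrow> complex ^ 'n ^ ('n \<times> 'n \<times> 'n \<times> 'n)" where
  "wedge_matrix I = (\<chi> k j. case k of (a, b, c, d) \<Rightarrow>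
     wedge13 (\<lambda>v. v $ j) I (axis a 1) (axis b 1) (axis c 1) (axis d 1))"

lemma wedge13_lincomb:
  "(\<Sum>j\<in>S. wedge13 (\<lambda>v. v $ j) I x y z w * u $ j) = wedge13 (\<lambda>v. \<Sum>j\<in>S. v $ j * u $ j) I x y z w"
  unfolding wedge13_def sum_distrib_right sum_subtractf[symmetric] sum.distrib[symmetric]
  by (intro sum.cong refl) (simp add: algebra_simps)

lemma linear_form_dot: "linear_form (\<lambda>v. \<Sum>j\<in>UNIV. v $ j * u $ j)"
  unfolding linear_form_iff sum_distrib_left sum.distrib[symmetric]
  by (simp add: distrib_right mult.assoc)

lemma linear_form_dot_nonzero:
  fixes u :: "complex ^ 'n"
  assumes "u \<noteq> 0" shows "\<exists>v. (\<Sum>j\<in>UNIV. v $ j * u $ j) \<noteq> 0"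
proof -
  obtain i where "u $ i \<noteq> 0" using assms by (auto simp: vec_eq_iff)
  moreover have "(\<Sum>j\<in>UNIV. axis i 1 $ j * u $ j) = u $ i"
    by (simp add: axis_def if_distrib[of "\<lambda>c. c * _"] cong: if_cong)
  ultimately show ?thesis by (intro exI[of _ "axis i 1"]) simp
qed

text \<open>
  A linear form is the same as the vector \<open>u\<close> of its values on the standard basis, and \<open>\<alpha> \<and> I\<close>, being
  linear in each argument, is zero as soon as it vanishes on basis vectors.
\<close>

lemma has_linear_factor_iff_kernel:
  assumes "I \<in> three_forms"
  shows "has_linear_factor I \<longleftrightarrow> (\<exists>u. u \<noteq> 0 \<and> wedge_matrix I *v u = 0)"
proof -
  have ker: "wedge_matrix I *v u = 0 \<longleftrightarrow>
      (\<forall>x y z w. wedge13 (\<lambda>v. \<Sum>j\<in>UNIV. v $ j * u $ j) I x y z w = 0)" (is "_ \<longleftrightarrow> ?R") for u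
  proof -
    have "wedge_matrix I *v u = 0 \<longleftrightarrow> (\<forall>a b c d.
        wedge13 (\<lambda>v. \<Sum>j\<in>UNIV. v $ j * u $ j) I (axis a 1) (axis b 1) (axis c 1) (axis d 1) = 0)"
      by (simp add: vec_eq_iff matrix_vector_mult_def wedge_matrix_def wedge13_lincomb)
    also have "\<dots> \<longleftrightarrow> ?R"
      using wedge13_eq_0_axis[OF linear_form_dot assms] by iprover
    finally show ?thesis .
  qed
  show ?thesis
  proof
    assume "has_linear_factor I"
    then obtain \<alpha> v where \<alpha>: "linear_form \<alpha>" "\<alpha> v \<noteq> 0" "\<forall>x y z w. wedge13 \<alpha> I x y z w = 0"
      unfolding has_linear_factor_def by blast
    define u where "u = (\<chi> i. \<alpha> (axis i 1))"
    have "\<alpha> = (\<lambda>v. \<Sum>j\<in>UNIV. v $ j * u $ j)"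
      unfolding u_def vec_lambda_beta by (rule ext) (rule linear_form_expansion[OF \<alpha>(1)])
    moreover from this \<alpha>(2) have "u \<noteq> 0" by auto
    ultimately show "\<exists>u. u \<noteq> 0 \<and> wedge_matrix I *v u = 0"
      using \<alpha>(3) ker[of u] by (intro exI[of _ u] conjI) simp_all
  next
    assume "\<exists>u. u \<noteq> 0 \<and> wedge_matrix I *v u = 0"
    then obtain u where u: "u \<noteq> 0" "wedge_matrix I *v u = 0" by blast
    show "has_linear_factor I"
      unfolding has_linear_factor_def
      using linear_form_dot linear_form_dot_nonzero[OF u(1)] u(2)[unfolded ker]
      by (intro exI[of _ "\<lambda>v. \<Sum>j\<in>UNIV. v $ j * u $ j"] conjI)
  qed
qed

lemma polynomial_fun_sum:
  "(\<And>i. i \<in> A \<Longrightarrow> polynomial_fun (f i)) \<Longrightarrow> polynomial_fun (\<lambda>I. \<Sum>i\<in>A. f i I)"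
  by (induction A rule: infinite_finite_induct) (auto intro: polynomial_fun.intros)

lemma polynomial_fun_prod:
  "(\<And>i. i \<in> A \<Longrightarrow> polynomial_fun (f i)) \<Longrightarrow> polynomial_fun (\<lambda>I. \<Prod>i\<in>A. f i I)"
  by (induction A rule: infinite_finite_induct) (auto intro: polynomial_fun.intros)

lemma polynomial_fun_diff:
  "polynomial_fun f \<Longrightarrow> polynomial_fun g \<Longrightarrow> polynomial_fun (\<lambda>I. f I - g I)"
  using polynomial_fun.add[OF _ polynomial_fun.mult[OF polynomial_fun.const[of "-1"]]] by fastforce

lemma polynomial_fun_det:
  "(\<And>i j. polynomial_fun (\<lambda>I. A I $ i $ j)) \<Longrightarrow> polynomial_fun (\<lambda>I. det (A I))"
  unfolding det_def
  by (intro polynomial_fun_sum polynomial_fun_prod polynomial_fun.mult polynomial_fun.const)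

lemma polynomial_fun_wedge_matrix: "polynomial_fun (\<lambda>I. wedge_matrix I $ k $ j)"
proof -
  obtain a b c d where "k = (a, b, c, d)" by (metis prod.exhaust)
  then show ?thesis
    by (simp add: wedge_matrix_def wedge13_def)
      (intro polynomial_fun_diff polynomial_fun.intros)
qed

lemma closedin_linear_factor: "closedin zariski {I \<in> three_forms. has_linear_factor I}"
proof -
  let ?P = "range (\<lambda>r I. det (\<chi> i. wedge_matrix I $ r i))"
  have "\<forall>f\<in>?P. polynomial_fun f"
    by (auto intro!: polynomial_fun_det simp: polynomial_fun_wedge_matrix simp del: split_paired_All)
  moreover have "{I \<in> three_forms. has_linear_factor I} = {I \<in> three_forms. \<forall>f\<in>?P. f I = 0}"
    using has_linear_factor_iff_kernel kernel_iff_minors[of "wedge_matrix _"] by auto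
  ultimately show ?thesis unfolding closedin_zariski by blast
qed

lemma S_set_closed: "closedin (subtopology zariski Q_set) S_set"
  unfolding closedin_subtopology S_set_eq
  using closedin_linear_factor Q_set_subset_three_forms by blast

lemma O_set_open: "openin (subtopology zariski Q_set) (O_set :: 'n::{finite,linorder} trilinear set)"
proof -
  have "topspace (subtopology zariski Q_set) = (Q_set :: 'n trilinear set)"
  proof -
    have "openin zariski (three_forms :: 'n trilinear set)"
      unfolding openin_zariski
      by (rule exI[of _ "{\<lambda>I. 1}"]) (auto intro: polynomial_fun.const)
    then have "(Q_set :: 'n trilinear set) \<subseteq> topspace zariski"
      using openin_subset Q_set_subset_three_forms by blast
    then show ?thesis by auto
  qed
  then have "openin (subtopology zariski Q_set) (Q_set - S_set :: 'n trilinear set)"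
    using openin_diff[OF openin_topspace S_set_closed] by metis
  moreover have "Q_set - S_set = (O_set :: 'n trilinear set)" unfolding O_set_eq S_set_eq by blast
  ultimately show ?thesis by simp
qed

section \<open>Three-forms in at most five dimensions\<close>

lemma Q_set_nonzero_coordinate:
  assumes "I \<in> Q_set"
  obtains i j k where "I (axis i 1) (axis j 1) (axis k 1) \<noteq> 0"
proof -
  obtain L where L: "I = assoc_form L" "\<not> abelian L"
    using assms unfolding Q_set_def by blast
  then have "\<exists>x y z. I x y z \<noteq> 0" by (simp add: abelian_iff_assoc_form)
  then show thesis
    using that three_form_eq_0 assms Q_set_subset_three_forms by blast
qed

text \<open>
  The factor is \<open>\<alpha> = I e\<^sub>i e\<^sub>j\<close>. It vanishes at \<open>e\<^sub>i\<close> and \<open>e\<^sub>j\<close>, so that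
  $(\alpha \wedge I)(e_i, e_j, z, w) = \alpha(z) \alpha(w) - \alpha(w) \alpha(z) = 0$; and in dimension at
  most 4, four distinct basis vectors always include \<open>e\<^sub>i\<close> and \<open>e\<^sub>j\<close>.
\<close>

lemma linear_factor_dim_le_4:
  fixes I :: "'n::{finite,linorder} trilinear"
  assumes I: "I \<in> three_forms" and n: "CARD('n) \<le> 4"
    and nz: "I (axis i 1) (axis j 1) (axis k 1) \<noteq> 0"
  shows "has_linear_factor I"
proof -
  define \<alpha> where "\<alpha> = I (axis i 1) (axis j 1)"
  have lin: "linear_form \<alpha>"
    using three_forms_linear(3)[OF I] by (simp add: \<alpha>_def)
  have ij: "wedge13 \<alpha> I (axis i 1) (axis j 1) z w = 0" for z w
    by (simp add: wedge13_def \<alpha>_def three_forms_repeat[OF I])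
  have "wedge13 \<alpha> I x y z w = 0" for x y z w
  proof (rule wedge13_eq_0_sorted[OF lin I])
    fix a b c d :: 'n
    assume "a < b" "b < c" "c < d"
    then have "a < c" "a < d" "b < d" by simp_all
    then have "card {a, b, c, d} = 4"
      using \<open>a < b\<close> \<open>b < c\<close> \<open>c < d\<close> by (simp add: less_imp_neq)
    then have "{a, b, c, d} = UNIV"
      using n card_subset_eq[of "UNIV :: 'n set" "{a, b, c, d}"] card_mono[of "UNIV :: 'n set" "{a, b, c, d}"]
      by simp
    then have sub: "{i, j} \<subseteq> {a, b, c, d}" by simp
    show "wedge13 \<alpha> I (axis a 1) (axis b 1) (axis c 1) (axis d 1) = 0"
      by (rule symmetric_relation4_contains[where i = i and j = j and
            Z = "\<lambda>a b c d. wedge13 \<alpha> I (axis a 1) (axis b 1) (axis c 1) (axis d 1) = 0"])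
        (erule wedge13_eq_0_swap[OF I] | rule sub | simp add: ij three_form_coordinate_distinct[OF I nz])+
  qed
  then show ?thesis
    unfolding has_linear_factor_def using lin nz by (intro exI[of _ \<alpha>]) (auto simp: \<alpha>_def)
qed

lemma det_skew_odd:
  fixes M :: "'a::field_char_0 ^ 'n ^ 'n"
  assumes "transpose M = - M" "odd CARD('n)"
  shows "det M = 0"
proof -
  have "det M = det (- M)" using det_transpose[of M] assms(1) by simp
  also have "- M = (\<chi> i. (- 1) *s M $ i)" by (simp add: vec_eq_iff)
  also have "det \<dots> = (\<Prod>i\<in>(UNIV :: 'n set). - 1) * det (\<chi> i. M $ i)" by (rule det_rows_mul)
  also have "\<dots> = - det M" using assms(2) by (simp add: vec_lambda_eta)
  finally show ?thesis by simp
qed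

text \<open>
  The 2-form dual to \<open>I\<close> has the matrix \<open>M\<close> with entries $\pm I(e_k, e_l, e_m)$, where $k < l < m$ is the
  complement of the two indices. Equivalently, its row \<open>a\<close> gives the value of
  $(-1)^a\, \alpha \wedge I$ on the four basis vectors other than $e_a$, which is the description
  used here: linear factors are then visibly the kernel of \<open>M\<close>.
\<close>

lemma linear_factor_dim_5:
  fixes I :: "'n::{finite,linorder} trilinear"
  assumes I: "I \<in> three_forms" and n: "CARD('n) = 5"
  shows "has_linear_factor I"
proof -
  define f :: "nat \<Rightarrow> 'n" where "f = inv idx_pos"
  have f_idx: "f (idx_pos i) = i" for i
    by (simp add: f_def inj_idx_pos)
  have idx_f: "idx_pos (f k) = k" if "k < 5" for k
    using that range_idx_pos[where 'n = 'n] n unfolding f_def by (intro f_inv_into_f) simp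
  have f_eq: "f k = f l \<longleftrightarrow> k = l" if "k < 5" "l < 5" for k l
    using idx_f that by metis
  have idx5: "idx_pos i < 5" for i :: 'n
    using idx_pos_less[of i] n by simp
  have idx_mono: "idx_pos i < idx_pos j" if "i < j" for i j :: 'n
    unfolding idx_pos_def using that by (intro psubset_card_mono) auto
  define e :: "nat \<Rightarrow> (complex, 'n) vec" where "e k = axis (f k) 1" for k
  have e_f: "e k $ f l = (if k = l then 1 else 0)" if "k < 5" "l < 5" for k l
    using f_eq[OF that] by (simp add: e_def axis_def eq_commute)
  \<comment> \<open>\<open>skip a\<close> enumerates in increasing order the indices other than \<open>a\<close>.\<close>
  define skip :: "nat \<Rightarrow> nat \<Rightarrow> nat" where "skip a k = (if k < a then k else k + 1)" for a k
  define W where "W \<beta> a = (-1) ^ a * wedge13 \<beta> I (e (skip a 0)) (e (skip a 1)) (e (skip a 2)) (e (skip a 3))"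
    for \<beta> a
  define M :: "((complex, 'n) vec, 'n) vec" where "M = (\<chi> i j. W (\<lambda>v. v $ j) (idx_pos i))"
  \<comment> \<open>For \<open>a \<noteq> b\<close>, both sides are up to sign the same value of \<open>I\<close> on the increasing complement of \<open>{a, b}\<close>; the sign
    \<open>(-1) ^ a\<close> in \<open>W\<close> is what makes them opposite.\<close>
  have skew: "W (\<lambda>v. v $ f b) a = - W (\<lambda>v. v $ f a) b" if "a < 5" "b < 5" for a b
  proof -
    have "a = 0 \<or> a = 1 \<or> a = 2 \<or> a = 3 \<or> a = 4" "b = 0 \<or> b = 1 \<or> b = 2 \<or> b = 3 \<or> b = 4"
      using that by linarith+
    then show ?thesis
      by (elim disjE) (simp_all add: W_def skip_def wedge13_def e_f flip: numeral_2_eq_2)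
  qed
  have "transpose M = - M"
    unfolding vec_eq_iff
  proof (intro allI)
    show "transpose M $ i $ j = (- M) $ i $ j" for i j
      using skew[OF idx5[of j] idx5[of i]] unfolding f_idx by (simp add: transpose_def M_def)
  qed
  then have "det M = 0" by (rule det_skew_odd) (simp add: n)
  then obtain u where u: "u \<noteq> 0" "M *v u = 0"
    using invertible_det_nz[of M] unfolding invertible_left_inverse matrix_left_invertible_ker by blast
  define \<alpha> where "\<alpha> = (\<lambda>v. \<Sum>j\<in>UNIV. v $ j * u $ j)"
  have lin: "linear_form \<alpha>" unfolding \<alpha>_def by (rule linear_form_dot)
  have W0: "W \<alpha> a = 0" if "a < 5" for a
  proof -
    have "W \<alpha> a = (\<Sum>j\<in>UNIV. W (\<lambda>v. v $ j) a * u $ j)"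
      unfolding W_def \<alpha>_def wedge13_lincomb[symmetric] by (simp add: sum_distrib_left mult.assoc)
    also have "\<dots> = (M *v u) $ f a"
      by (simp add: M_def matrix_vector_mult_def idx_f that)
    finally show ?thesis using u(2) by simp
  qed
  have "wedge13 \<alpha> I x y z w = 0" for x y z w
  proof (rule wedge13_eq_0_sorted[OF lin I])
    fix a b c d :: 'n
    assume "a < b" "b < c" "c < d"
    then have ord: "idx_pos a < idx_pos b" "idx_pos b < idx_pos c" "idx_pos c < idx_pos d"
      by (simp_all add: idx_mono)
    \<comment> \<open>The missing index, as all five indices add up to 10.\<close>
    define m where "m = 10 - (idx_pos a + idx_pos b + idx_pos c + idx_pos d)"
    have "idx_pos a = 0 \<or> idx_pos a = 1" "idx_pos b = 1 \<or> idx_pos b = 2"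
        "idx_pos c = 2 \<or> idx_pos c = 3" "idx_pos d = 3 \<or> idx_pos d = 4"
      using ord idx5[of d] by linarith+
    then have m: "m < 5 \<and> idx_pos a = skip m 0 \<and> idx_pos b = skip m 1 \<and> idx_pos c = skip m 2 \<and>
        idx_pos d = skip m 3"
      using ord by (elim disjE) (simp_all add: m_def skip_def)
    have "e (skip m 0) = axis a 1" "e (skip m 1) = axis b 1" "e (skip m 2) = axis c 1"
        "e (skip m 3) = axis d 1"
      using m f_idx unfolding e_def by metis+
    then show "wedge13 \<alpha> I (axis a 1) (axis b 1) (axis c 1) (axis d 1) = 0"
      using W0[of m] m by (simp add: W_def)
  qed
  then show ?thesis
    unfolding has_linear_factor_def
    using lin linear_form_dot_nonzero[OF u(1)] by (intro exI[of _ \<alpha>]) (simp add: \<alpha>_def)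
qed

lemma Q_set_card_ge_3:
  assumes "(Q_set :: 'n::{finite,linorder} trilinear set) \<noteq> {}"
  shows "CARD('n) \<ge> 3"
proof -
  obtain I :: "'n trilinear" where I: "I \<in> Q_set" using assms by blast
  then obtain i j k where nz: "I (axis i 1) (axis j 1) (axis k 1) \<noteq> 0"
    by (rule Q_set_nonzero_coordinate)
  have "I \<in> three_forms" using I Q_set_subset_three_forms by blast
  then have "card {i, j, k} = 3"
    using three_form_coordinate_distinct[of I i j k] nz by simp
  then show ?thesis using card_mono[of "UNIV :: 'n set" "{i, j, k}"] by simp
qed

lemma O_set_card_ge_6:
  assumes "(O_set :: 'n::{finite,linorder} trilinear set) \<noteq> {}"
  shows "CARD('n) \<ge> 6"
proof (rule ccontr)
  assume n: "\<not> CARD('n) \<ge> 6"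
  obtain I :: "'n trilinear" where I: "I \<in> Q_set" "\<not> has_linear_factor I"
    using assms unfolding O_set_eq by blast
  then have I3: "I \<in> three_forms" using Q_set_subset_three_forms by blast
  obtain i j k where "I (axis i 1) (axis j 1) (axis k 1) \<noteq> 0"
    using I(1) by (rule Q_set_nonzero_coordinate)
  then have "has_linear_factor I"
    using linear_factor_dim_le_4[OF I3] linear_factor_dim_5[OF I3] n by (cases "CARD('n) \<le> 4") auto
  then show False using I(2) by blast
qed

section \<open>Decomposable structures and their orthogonal sums\<close>

lemma can_form_linear_simps:
  "can_form (x + y) z = can_form x z + can_form y z"
  "can_form z (x + y) = can_form z x + can_form z y"
  "can_form (x - y) z = can_form x z - can_form y z"
  "can_form z (x - y) = can_form z x - can_form z y"
  "can_form (c *s x) z = c * can_form x z"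
  "can_form z (c *s x) = c * can_form z x"
  "can_form 0 z = 0" "can_form z 0 = 0"
proof -
  note lin = can_form_linear_left[of z, unfolded linear_form_iff]
    can_form_linear_right[of z, unfolded linear_form_iff]
  show add: "can_form (x + y) z = can_form x z + can_form y z"
    "can_form z (x + y) = can_form z x + can_form z y" for x y
    using lin by iprover+
  show "can_form (x - y) z = can_form x z - can_form y z"
    "can_form z (x - y) = can_form z x - can_form z y"
    using add[of "x - y" y] by simp_all
  show "can_form (c *s x) z = c * can_form x z" "can_form z (c *s x) = c * can_form z x"
    using lin by iprover+
  show "can_form 0 z = 0" "can_form z 0 = 0"
    using add[of 0 0] by simp_all
qed

lemma linear_map_iff:
  fixes f :: "complex ^ 'm \<Rightarrow> complex ^ 'n"
  shows "Vector_Spaces.linear (*s) (*s) f \<longleftrightarrow>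
    (\<forall>x y. f (x + y) = f x + f y) \<and> (\<forall>c x. f (c *s x) = c *s f x)"
proof -
  have "vector_space ((*s) :: complex \<Rightarrow> complex ^ 'm \<Rightarrow> complex ^ 'm)"
    and "vector_space ((*s) :: complex \<Rightarrow> complex ^ 'n \<Rightarrow> complex ^ 'n)"
    by (rule vec.vector_space_axioms)+
  then show ?thesis by (simp add: Vector_Spaces.linear_iff)
qed

text \<open>
  The bracket whose associated 3-form is $a^\flat \wedge b^\flat \wedge c^\flat$ with
  $a^\flat = B(a, \cdot)$; for an orthonormal basis of a 3-dimensional space it is the cross product.
\<close>

definition triple_bracket ::
    "(complex, 'n) vec \<Rightarrow> (complex, 'n) vec \<Rightarrow> (complex, 'n) vec \<Rightarrow> 'n::{finite,linorder} bracket" where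
  "triple_bracket a b c x y =
     (can_form b x * can_form c y - can_form b y * can_form c x) *s a +
     (can_form c x * can_form a y - can_form c y * can_form a x) *s b +
     (can_form a x * can_form b y - can_form a y * can_form b x) *s c"

lemma assoc_form_triple_bracket:
  "assoc_form (triple_bracket a b c) x y z =
     (can_form b x * can_form c y - can_form b y * can_form c x) * can_form a z +
     (can_form c x * can_form a y - can_form c y * can_form a x) * can_form b z +
     (can_form a x * can_form b y - can_form a y * can_form b x) * can_form c z"
  by (simp add: assoc_form_def triple_bracket_def can_form_linear_simps left_diff_distrib)

text \<open>
  Invariance holds because the associated form is alternating. The Jacobi identity is a polynomial
  identity in the values of \<open>a\<close>, \<open>b\<close>, \<open>c\<close> on the arguments and in the Gram matrix of \<open>a, b, c\<close>.
  Invariantly, the Jacobi expression corresponds to a 4-form in the three covectors of \<open>a\<close>, \<open>b\<close>,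
  \<open>c\<close>, and there is no such form but 0.
\<close>

lemma quadratic_structure_triple_bracket:
  "quadratic_structure (triple_bracket a b c)"
  unfolding quadratic_structure_def lie_bracket_def
proof (intro conjI allI)
  let ?L = "triple_bracket a b c"
  show "Vector_Spaces.linear (*s) (*s) (\<lambda>x. ?L x y)" "Vector_Spaces.linear (*s) (*s) (?L y)" for y
    by (simp_all add: linear_map_iff triple_bracket_def can_form_linear_simps vec_eq_iff algebra_simps)
  show "?L x x = 0" for x by (simp add: triple_bracket_def vec_eq_iff)
  show "can_form (?L x y) z = can_form x (?L y z)" for x y z
    unfolding can_form_sym[of x "?L y z"] assoc_form_def[symmetric] assoc_form_triple_bracket
    by (simp add: algebra_simps)
  have sym: "can_form b a = can_form a b" "can_form c a = can_form a c" "can_form c b = can_form b c"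
    by (simp_all add: can_form_sym)
  show "?L x (?L y z) + ?L y (?L z x) + ?L z (?L x y) = 0" for x y z
    by (simp add: triple_bracket_def can_form_linear_simps vec_eq_iff sym) algebra
qed

text \<open>
  The assumptions are precisely the vanishing of the mixed terms in the Jacobi identity of the sum.
\<close>

lemma quadratic_structure_add:
  assumes L: "quadratic_structure L" and M: "quadratic_structure M"
    and orth1: "\<And>x y z. L x (M y z) = 0" and orth2: "\<And>x y z. M x (L y z) = 0"
  shows "quadratic_structure (\<lambda>x y. L x y + M x y)"
  unfolding quadratic_structure_def lie_bracket_def
proof (intro conjI allI)
  have lin: "Vector_Spaces.linear (*s) (*s) (\<lambda>x. L x y)" "Vector_Spaces.linear (*s) (*s) (L y)"
      "Vector_Spaces.linear (*s) (*s) (\<lambda>x. M x y)" "Vector_Spaces.linear (*s) (*s) (M y)" for y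
    using L M by (simp_all add: quadratic_structure_def lie_bracket_def)
  then show "Vector_Spaces.linear (*s) (*s) (\<lambda>x. L x y + M x y)"
      "Vector_Spaces.linear (*s) (*s) (\<lambda>x. L y x + M y x)" for y
    by (simp_all add: linear_map_iff vec.scale_right_distrib add_ac)
  show "L x x + M x x = 0" for x
    using L M by (simp add: quadratic_structure_def lie_bracket_def)
  show "can_form (L x y + M x y) z = can_form x (L y z + M y z)" for x y z
    using L M by (simp add: quadratic_structure_def can_form_linear_simps)
  show "L x (L y z + M y z) + M x (L y z + M y z) + (L y (L z x + M z x) + M y (L z x + M z x)) +
      (L z (L x y + M x y) + M z (L x y + M x y)) = 0" for x y z
  proof -
    have "L x (L y z) + L y (L z x) + L z (L x y) = 0" "M x (M y z) + M y (M z x) + M z (M x y) = 0"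
      using L M by (simp_all add: quadratic_structure_def lie_bracket_def)
    then have "(L x (L y z) + L y (L z x) + L z (L x y)) + (M x (M y z) + M y (M z x) + M z (M x y)) = 0"
      by simp
    moreover have "L u (v + w) = L u v + L u w" "M u (v + w) = M u v + M u w" for u v w
      using lin by (simp_all add: linear_map_iff)
    ultimately show ?thesis by (simp add: orth1 orth2 add_ac)
  qed
qed

text \<open>
  In the intended use \<open>I = I\<^sub>1 + I\<^sub>2\<close>, with \<open>I\<^sub>1\<close> and \<open>I\<^sub>2\<close> living on complementary
  triples. Evaluating \<open>\<alpha> \<and> I = 0\<close> on one \<open>u\<close> and all the \<open>w\<close> kills \<open>\<alpha> u\<close>; then evaluating it on an
  arbitrary vector and all the \<open>u\<close> kills \<open>\<alpha>\<close>.
\<close>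

lemma no_linear_factor:
  assumes u: "I u1 u2 u3 \<noteq> 0" and w: "I w1 w2 w3 \<noteq> 0"
    and mixed: "\<And>u. u \<in> {u1, u2, u3} \<Longrightarrow> I u w2 w3 = 0 \<and> I u w1 w3 = 0 \<and> I u w1 w2 = 0"
  shows "\<not> has_linear_factor I"
proof
  assume "has_linear_factor I"
  then obtain \<alpha> v where \<alpha>: "\<alpha> v \<noteq> 0" "\<And>x y z w. wedge13 \<alpha> I x y z w = 0"
    unfolding has_linear_factor_def by blast
  have "\<alpha> u = 0" if "u \<in> {u1, u2, u3}" for u
    using \<alpha>(2)[of u w1 w2 w3] mixed[OF that] w by (simp add: wedge13_def)
  then show False
    using \<alpha>(2)[of v u1 u2 u3] \<alpha>(1) u by (simp add: wedge13_def)
qed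

text \<open>
  Indexing the standard basis by positions: with \<open>p = n div 2\<close> and \<open>q = n - p\<close>, the vector $E_k$ is
  \<open>basis_vec k\<close> and $F_k$ is \<open>basis_vec (q + k)\<close> for \<open>k < p\<close>, counting from 0, and for odd \<open>n\<close> the
  vector $G$ is \<open>basis_vec p\<close>.
\<close>

definition basis_vec :: "nat \<Rightarrow> (complex, 'n::{finite,linorder}) vec" where
  "basis_vec k = axis (inv idx_pos k) 1"

lemma can_form_basis_vec:
  assumes n: "CARD('n) = p + q" "q = p \<or> q = Suc p" and "k < p + q" "l < p + q"
  shows "can_form (basis_vec k :: (complex, 'n::{finite,linorder}) vec) (basis_vec l) =
    (if l = k + q \<or> k = l + q \<or> q = Suc p \<and> k = p \<and> l = p then 1 else 0)"
proof -
  have "idx_pos (inv idx_pos m :: 'n) = m" if "m < p + q" for m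
    using that range_idx_pos[where 'n = 'n] n(1) by (intro f_inv_into_f) simp
  moreover have "CARD('n) div 2 = p" "CARD('n) - p = q" "odd CARD('n) \<longleftrightarrow> q = Suc p"
    using n by auto
  ultimately show ?thesis
    using assms(3,4) unfolding basis_vec_def can_form_axis paired_def Let_def by simp
qed

lemma half_dimensions:
  obtains p q :: nat where "n = p + q" "q = p \<or> q = Suc p"
proof
  show "n = n div 2 + (n - n div 2)" "n - n div 2 = n div 2 \<or> n - n div 2 = Suc (n div 2)"
    by presburger+
qed

text \<open>
  The triple is \<open>E\<^sub>0, F\<^sub>0, g\<close>, with \<open>g = G\<close> for \<open>n = 3\<close> and \<open>g = E\<^sub>1\<close> otherwise. The vector \<open>h\<close> is the
  basis vector paired with \<open>g\<close>; with \<open>F\<^sub>0\<close> and \<open>E\<^sub>0\<close> it shows that the form is not zero.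
\<close>

lemma Q_set_nonempty:
  assumes "CARD('n::{finite,linorder}) \<ge> 3"
  shows "(Q_set :: 'n trilinear set) \<noteq> {}"
proof -
  obtain p q where n: "CARD('n) = p + q" "q = p \<or> q = Suc p" by (rule half_dimensions)
  let ?e = "basis_vec :: nat \<Rightarrow> (complex, 'n) vec"
  define g where "g = ?e 1"
  define h where "h = ?e (if p = 1 then 1 else q + 1)"
  let ?L = "triple_bracket (?e 0) (?e q) g"
  note B = can_form_basis_vec[OF n]
  have "p \<ge> 1" "q \<ge> 2" "p = 1 \<longrightarrow> q = 2" using n assms by auto
  then have gram: "can_form (?e 0) (?e 0) = 0" "can_form (?e q) (?e q) = 0"
      "can_form (?e 0) (?e q) = 1" "can_form (?e q) (?e 0) = 1"
      "can_form (?e 0) h = 0" "can_form (?e q) h = 0" "can_form g h = 1"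
    by (simp_all add: g_def h_def B)
  have "assoc_form ?L (?e q) (?e 0) h \<noteq> 0"
    by (simp add: assoc_form_triple_bracket gram)
  then have "\<not> abelian ?L" using abelian_iff_assoc_form by blast
  then have "assoc_form ?L \<in> Q_set"
    unfolding Q_set_def using quadratic_structure_triple_bracket by blast
  then show ?thesis by blast
qed

text \<open>
  The middle hyperbolic plane is split into the orthogonal lines spanned by \<open>E\<^sub>1 + F\<^sub>1\<close> and
  \<open>E\<^sub>1 - F\<^sub>1\<close>, and each is added to one of the other two planes. This gives two orthogonal
  non-degenerate 3-spaces, and the algebra is the sum of two simple algebras of dimension 3 and an
  Abelian one.
\<close>

lemma O_set_nonempty:
  assumes "CARD('n::{finite,linorder}) \<ge> 6"
  shows "(O_set :: 'n trilinear set) \<noteq> {}"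
proof -
  obtain p q where n: "CARD('n) = p + q" "q = p \<or> q = Suc p" by (rule half_dimensions)
  then have "p \<ge> 3" "q \<ge> 3" using assms by auto
  define E where "E k = (basis_vec k :: (complex, 'n) vec)" for k
  define F where "F k = (basis_vec (q + k) :: (complex, 'n) vec)" for k
  have gram: "can_form (E k) (E l) = 0" "can_form (F k) (F l) = 0"
      "can_form (E k) (F l) = (if k = l then 1 else 0)" "can_form (F k) (E l) = (if k = l then 1 else 0)"
    if "k < 3" "l < 3" for k l
    using that \<open>p \<ge> 3\<close> \<open>q \<ge> 3\<close> n(2) by (simp_all add: E_def F_def can_form_basis_vec[OF n])
  define g where "g = E 1 + F 1"
  define h where "h = E 1 - F 1"
  define L where "L = triple_bracket (E 0) (F 0) g"
  define M where "M = triple_bracket (E 2) (F 2) h"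
  have gh: "can_form g g = 2" "can_form h h = - 2" "can_form g h = 0" "can_form h g = 0"
    by (simp_all add: g_def h_def can_form_linear_simps gram)
  have gh2: "can_form (E k) g = 0" "can_form (F k) g = 0" "can_form g (E k) = 0" "can_form g (F k) = 0"
    "can_form (E k) h = 0" "can_form (F k) h = 0" "can_form h (E k) = 0" "can_form h (F k) = 0"
    if "k \<in> {0, 2}" for k
    using that by (auto simp: g_def h_def can_form_linear_simps gram)
  have orth: "L x (M y z) = 0" "M x (L y z) = 0" for x y z
    unfolding L_def M_def triple_bracket_def[of _ _ _ x]
    by (simp_all add: triple_bracket_def can_form_linear_simps gram gh gh2)
  let ?N = "\<lambda>x y. L x y + M x y"
  have quad: "quadratic_structure ?N"
    using quadratic_structure_add orth quadratic_structure_triple_bracket unfolding L_def M_def by blast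
  have form: "assoc_form ?N x y z = assoc_form L x y z + assoc_form M x y z" for x y z
    by (simp add: assoc_form_def can_form_linear_simps)
  note simps = form[unfolded L_def M_def] L_def M_def assoc_form_triple_bracket gram gh gh2
  have nz: "assoc_form ?N (E 0) (F 0) g \<noteq> 0" "assoc_form ?N (E 2) (F 2) h \<noteq> 0"
    by (simp_all add: simps)
  have "\<not> has_linear_factor (assoc_form ?N)"
    by (rule no_linear_factor[where I = "assoc_form ?N", OF nz]) (auto simp: simps)
  moreover have "assoc_form ?N \<in> Q_set"
    using quad nz(1) abelian_iff_assoc_form unfolding Q_set_def by blast
  ultimately show ?thesis unfolding O_set_eq by blast
qed

section \<open>Openness, closedness and existence\<close>

theorem theorem1:
  shows "openin (subtopology zariski Q_set) (O_set :: 'n::{finite,linorder} trilinear set) \<and>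
    closedin (subtopology zariski Q_set) (S_set :: 'n trilinear set) \<and>
    ((Q_set :: 'n trilinear set) \<noteq> {} \<longleftrightarrow> CARD('n) \<ge> 3) \<and>
    ((O_set :: 'n trilinear set) \<noteq> {} \<longleftrightarrow> CARD('n) \<ge> 6)"
  using O_set_open S_set_closed Q_set_card_ge_3 Q_set_nonempty O_set_card_ge_6 O_set_nonempty
  by blast

end
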